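(* For every $n\ge0$, the number $d(n)=|\{\mathbf a(\pi)+\mathbf b(\pi):\pi\in\mathcal D(n)\}|$ of distinct values of area plus bounce over Dyck paths of semilength $n$ (equivalently, the number of terms of $\sum_{\pi\in\mathcal D(n)}q^{\mathbf a(\pi)+\mathbf b(\pi)}$) equals the number of nonzero coefficients of the polynomial $B_n(q)$.
   Context: A Dyck path of semilength $n$ is a lattice path from $(0,0)$ to $(n,n)$ with unit north and east steps never going below $y=x$; $\mathcal D(n)$ is their set. The area $\mathbf a(\pi)$ is the number of whole unit cells between $\pi$ and the diagonal. With $h_i$ the $y$-coordinate of the east step of $\pi$ in column $i$ (strip $i-1\le x\le i$), the bounce points are $b_0=0$, $b_k=h_{b_{k-1}+1}$ until $b_m=n$, and the bounce is $\mathbf b(\pi)=\sum_{k=1}^m(n-b_k)$. Johnson's $q$-Bell polynomials are defined by $B_0(q)=1$ and $B_n(q)=\sum_{k=0}^{n-1}\binom{n-1}{k}_q B_k(q)$ for $n\ge1$, where $\binom{n}{k}_q$ is the Gaussian ($q$-binomial) coefficient. *)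

theory Defs
  imports "HOL-Computational_Algebra.Polynomial"
begin

datatype step = North | East

(* The lattice point (x, y) reached from the origin after the first k steps. *)
definition path_point :: "step list \<Rightarrow> nat \<Rightarrow> nat \<times> nat" where
  "path_point \<pi> k = (count_list (take k \<pi>) East, count_list (take k \<pi>) North)"

definition dyck_paths :: "nat \<Rightarrow> step list set" where
  "dyck_paths n =
     {\<pi>. path_point \<pi> (length \<pi>) = (n, n) \<and>
          (\<forall>k \<le> length \<pi>. fst (path_point \<pi> k) \<le> snd (path_point \<pi> k))}"

(* Columns are numbered from 1: the east step in column i is the one ending at x = i.
   Meaningful only if the path has such a step. *)
definition col_height :: "step list \<Rightarrow> nat \<Rightarrow> nat" where
  "col_height \<pi> i =
     (THE y. \<exists>k < length \<pi>. \<pi> ! k = East \<and> path_point \<pi> (Suc k) = (i, y))"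

(* (i, j) stands for the unit cell [i-1, i] x [j-1, j]: it lies under the path iff
   j \<le> col_height \<pi> i, and entirely above the diagonal iff i \<le> j-1. *)
definition area :: "nat \<Rightarrow> step list \<Rightarrow> nat" where
  "area n \<pi> = card {(i, j). 1 \<le> i \<and> i \<le> n \<and> i < j \<and> j \<le> col_height \<pi> i}"

primrec bounce_point :: "step list \<Rightarrow> nat \<Rightarrow> nat" where
  "bounce_point \<pi> 0 = 0"
| "bounce_point \<pi> (Suc k) = col_height \<pi> (bounce_point \<pi> k + 1)"

definition bounce :: "nat \<Rightarrow> step list \<Rightarrow> nat" where
  "bounce n \<pi> = (\<Sum>k = 1..(LEAST m. bounce_point \<pi> m = n). n - bounce_point \<pi> k)"

definition num_values :: "nat \<Rightarrow> nat" where
  "num_values n = card ((\<lambda>\<pi>. area n \<pi> + bounce n \<pi>) ` dyck_paths n)"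

(* Gaussian coefficients via the q-Pascal rule; qbinom_qfact below is the usual
   q-factorial formula. *)
fun qbinom :: "nat \<Rightarrow> nat \<Rightarrow> int poly" where
  "qbinom n 0 = 1"
| "qbinom 0 (Suc k) = 0"
| "qbinom (Suc n) (Suc k) = qbinom n k + monom 1 (Suc k) * qbinom n (Suc k)"

definition qint :: "nat \<Rightarrow> int poly" where
  "qint n = (\<Sum>i<n. monom 1 i)"

definition qfact :: "nat \<Rightarrow> int poly" where
  "qfact n = (\<Prod>i=1..n. qint i)"

lemma qbinom_eq_0: "n < k \<Longrightarrow> qbinom n k = 0"
  by (induction n k rule: qbinom.induct) auto

lemma qint_add: "qint (m + n) = qint m + monom 1 m * qint n"
  by (induction n) (simp_all add: qint_def algebra_simps mult_monom)

lemma qfact_0: "qfact 0 = 1"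
  by (simp add: qfact_def)

lemma qfact_Suc: "qfact (Suc n) = qint (Suc n) * qfact n"
  by (simp add: qfact_def mult.commute)

lemma qbinom_qfact: "k \<le> n \<Longrightarrow> qbinom n k * (qfact k * qfact (n - k)) = qfact n"
proof (induction n k rule: qbinom.induct)
  case (3 n k)
  have IH1: "qbinom n k * (qfact k * qfact (n - k)) = qfact n"
    using 3 by simp
  show ?case
  proof (cases "k = n")
    case True
    then show ?thesis using IH1
      by (simp add: qbinom_eq_0 qfact_0 qfact_Suc mult.left_commute)
  next
    case False
    then obtain d where d: "n - k = Suc d" "n - Suc k = d" "Suc n = Suc k + Suc d"
      using "3.prems" by (metis Suc_diff_Suc Suc_le_mono add_Suc le_add_diff_inverse le_neq_implies_less)
    have IH2: "qbinom n (Suc k) * (qfact (Suc k) * qfact d) = qfact n"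
      using 3 False d by simp
    have "qbinom (Suc n) (Suc k) * (qfact (Suc k) * qfact (Suc n - Suc k)) =
        qint (Suc k) * (qbinom n k * (qfact k * qfact (n - k))) +
        monom 1 (Suc k) * qint (Suc d) * (qbinom n (Suc k) * (qfact (Suc k) * qfact d))"
      by (simp add: d(1) qfact_Suc algebra_simps)
    also have "\<dots> = qint (Suc k + Suc d) * qfact n"
      unfolding IH1 IH2 qint_add by (simp add: algebra_simps)
    finally show ?thesis
      using d(3) by (simp add: qfact_Suc)
  qed
qed (simp_all add: qfact_0)

fun qbell :: "nat \<Rightarrow> int poly" where
  "qbell 0 = 1"
| "qbell (Suc n) = (\<Sum>k\<le>n. qbinom n k * qbell k)"

definition num_terms :: "int poly \<Rightarrow> nat" where
  "num_terms p = card {i. coeff p i \<noteq> 0}"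

end

theory Submission
  imports Defs
begin

text \<open>
  Write \<open>h i\<close> for the height of column \<open>i + 1\<close>. The area together with the sum of all \<open>n - h i\<close> is
  \<open>n (n - 1) / 2\<close>, and the bounce is the part of the latter sum contributed by the columns that follow
  a bounce point. So area plus bounce plus defect is constant, where the defect is the sum of
  \<open>n - h i\<close> over all other columns.

  The paths whose bounce points cut \<open>n\<close> into the composition \<open>c\<close> realise as defects exactly an
  interval whose upper end is \<open>max_defect c\<close>, the sum of the \<open>(c\<^sub>i - 1) (c\<^sub>i\<^sub>+\<^sub>1 + c\<^sub>i\<^sub>+\<^sub>2 + \<dots>)\<close>. Merging the last two
  parts of \<open>c\<close> gives a composition whose interval reaches up to the lower end of the
  interval of \<open>c\<close>, and the one-part composition has defect 0. So all values up to \<open>max_defect c\<close> occur.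
  Unfolding the recursion of the q-Bell polynomial, with the exponents of a Gaussian coefficient
  filling an interval that starts at 0, gives the same union of the intervals from 0 to \<open>max_defect c\<close>.
\<close>

section \<open>Compositions\<close>

fun max_defect :: "nat list \<Rightarrow> nat" where
  "max_defect [] = 0"
| "max_defect (c # cs) = (c - 1) * sum_list cs + max_defect cs"

text \<open>A non-bounce column in the block of \<open>c\<close> is at most as high as the next
  bounce column, so it contributes at least \<open>sum_list (tl cs)\<close>.\<close>

fun min_defect :: "nat list \<Rightarrow> nat" where
  "min_defect [] = 0"
| "min_defect (c # cs) = (c - 1) * sum_list (tl cs) + min_defect cs"

definition defects :: "nat \<Rightarrow> nat set" where
  "defects n = {v. \<exists>cs. sum_list cs = n \<and> 0 \<notin> set cs \<and> v \<le> max_defect cs}"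

fun merge_last :: "nat list \<Rightarrow> nat list" where
  "merge_last [a, b] = [a + b]"
| "merge_last (a # cs) = a # merge_last cs"
| "merge_last [] = []"

lemma sum_list_merge_last [simp]: "sum_list (merge_last cs) = sum_list cs"
  by (induction cs rule: merge_last.induct) auto

lemma zero_notin_merge_last: "0 \<notin> set cs \<Longrightarrow> 0 \<notin> set (merge_last cs)"
  by (induction cs rule: merge_last.induct) auto

lemma length_merge_last: "2 \<le> length cs \<Longrightarrow> length (merge_last cs) < length cs"
  by (induction cs rule: merge_last.induct) (auto simp: Suc_le_eq neq_Nil_conv)

text \<open>Merging keeps the sum behind every earlier part, so the bound holds term by term; the
  last two parts add 0 to \<open>min_defect\<close>.\<close>

lemma min_defect_le_merge_last: "min_defect cs \<le> max_defect (merge_last cs)"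
proof (induction cs rule: merge_last.induct)
  case ("2_2" a b c cs)
  have "(a - 1) * sum_list (c # cs) \<le> (a - 1) * sum_list (b # c # cs)"
    by (intro mult_le_mono) auto
  from add_mono[OF this "2_2"] show ?case by simp
qed auto

lemma composition_with_defect:
  assumes "0 \<notin> set cs" and "v \<le> max_defect cs"
  obtains ds where "sum_list ds = sum_list cs" "0 \<notin> set ds" "min_defect ds \<le> v" "v \<le> max_defect ds"
  using assms
proof (induction cs arbitrary: thesis rule: length_induct)
  case (1 cs)
  show ?case
  proof (cases "min_defect cs \<le> v")
    case True
    with 1 show ?thesis by blast
  next
    case False
    \<comment> \<open>With at most one part \<open>min_defect\<close> is 0, which no
      \<open>v\<close> can undercut, so there are two parts to merge.\<close>
    have "2 \<le> length cs"
    proof (rule ccontr)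
      assume "\<not> 2 \<le> length cs"
      then have "cs = [] \<or> (\<exists>c. cs = [c])" by (cases cs) (auto simp: Suc_le_eq)
      with False show False by auto
    qed
    then show ?thesis
      using 1(1)[rule_format, of "merge_last cs"] 1(2,3) False min_defect_le_merge_last[of cs]
        length_merge_last[of cs] zero_notin_merge_last[of cs]
      by (metis nle_le order_trans sum_list_merge_last)
  qed
qed

section \<open>The recursion for the set of defects\<close>

lemma defects_0: "defects 0 = {0}"
proof -
  have "sum_list cs = 0 \<Longrightarrow> 0 \<notin> set cs \<Longrightarrow> cs = []" for cs :: "nat list"
    by (cases cs) auto
  then show ?thesis
    by (fastforce simp: defects_def intro: exI[of _ "[]"])
qed

lemma defects_extend:
  assumes "w \<in> defects k" and "u \<le> (c - 1) * k" and "0 < c"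
  shows "u + w \<in> defects (c + k)"
proof -
  obtain cs where cs: "sum_list cs = k" "0 \<notin> set cs" "w \<le> max_defect cs"
    using assms(1) unfolding defects_def by auto
  then show ?thesis
    unfolding defects_def using assms(2,3) by (auto intro!: exI[of _ "c # cs"] add_mono)
qed

text \<open>Shaped after the recursion of \<open>qbell\<close>: \<open>k\<close> is what the first
  part \<open>Suc n - k\<close> leaves over, and \<open>u\<close> runs through the exponents of
  \<open>qbinom n k\<close>.\<close>

lemma defects_Suc:
  "v \<in> defects (Suc n) \<longleftrightarrow> (\<exists>k\<le>n. \<exists>u w. u \<le> k * (n - k) \<and> w \<in> defects k \<and> v = u + w)"
proof
  assume "v \<in> defects (Suc n)"
  then obtain cs where cs: "sum_list cs = Suc n" "0 \<notin> set cs" "v \<le> max_defect cs"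
    unfolding defects_def by auto
  then obtain c ds where eq: "cs = c # ds" by (cases cs) auto
  define k where "k = sum_list ds"
  have k: "k \<le> n" "c - 1 = n - k" using cs eq unfolding k_def by auto
  have ds: "\<And>w. w \<le> max_defect ds \<Longrightarrow> w \<in> defects k"
    using cs eq unfolding defects_def k_def by auto
  have "v \<le> k * (n - k) + max_defect ds"
    using cs eq k unfolding k_def by (simp add: mult.commute)
  then obtain u w where "u \<le> k * (n - k)" "w \<le> max_defect ds" "v = u + w"
    by (metis add.commute le_cases le_iff_add nat_add_left_cancel_le add_0_right le0)
  then show "\<exists>k\<le>n. \<exists>u w. u \<le> k * (n - k) \<and> w \<in> defects k \<and> v = u + w"
    using k(1) ds by blast
next
  assume "\<exists>k\<le>n. \<exists>u w. u \<le> k * (n - k) \<and> w \<in> defects k \<and> v = u + w"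
  then obtain k u w where *: "k \<le> n" "u \<le> k * (n - k)" "w \<in> defects k" "v = u + w" by blast
  then have "u + w \<in> defects (Suc (n - k) + k)"
    by (intro defects_extend) (auto simp: mult.commute)
  with * show "v \<in> defects (Suc n)" by simp
qed

section \<open>Exponents of the q-Bell polynomials\<close>

lemma coeff_qbinom_nonneg: "0 \<le> coeff (qbinom n k) i"
  by (induction n k arbitrary: i rule: qbinom.induct)
    (auto simp: coeff_monom_mult coeff_1)

text \<open>Nothing cancels, so the q-Pascal rule unites the interval from 0 to
  \<open>k * (n - k)\<close> with the one from \<open>Suc k\<close> to
  \<open>Suc k * (n - k)\<close>. For \<open>k < n\<close> the first reaches at least
  \<open>k\<close>, so there is no gap.\<close>

lemma coeff_qbinom_pos_iff: "0 < coeff (qbinom n k) i \<longleftrightarrow> k \<le> n \<and> i \<le> k * (n - k)"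
proof (induction n k arbitrary: i rule: qbinom.induct)
  case (3 n k)
  have *: "0 < coeff (qbinom (Suc n) (Suc k)) i \<longleftrightarrow>
      k \<le> n \<and> i \<le> k * (n - k) \<or>
      Suc k \<le> i \<and> Suc k \<le> n \<and> i - Suc k \<le> Suc k * (n - Suc k)"
    using coeff_qbinom_nonneg[of n k i] coeff_qbinom_nonneg[of n "Suc k" "i - Suc k"]
      3(1)[of i] 3(2)[of "i - Suc k"]
    by (auto simp: coeff_monom_mult simp del: mult_Suc)
  show ?case
  proof (cases "k < n")
    case True
    then obtain d where "n = Suc k + d" using less_iff_Suc_add by auto
    then show ?thesis unfolding * by (auto simp: algebra_simps)
  qed (unfold *, auto)
qed (auto simp: coeff_1)

lemma coeff_mult_nonneg:
  fixes p q :: "int poly"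
  assumes "\<And>i. 0 \<le> coeff p i" and "\<And>i. 0 \<le> coeff q i"
  shows "0 \<le> coeff (p * q) i"
  using assms by (auto simp: coeff_mult intro!: sum_nonneg)

lemma sum_nonneg_pos_iff:
  fixes f :: "'a \<Rightarrow> int"
  assumes "finite A" and "\<And>x. x \<in> A \<Longrightarrow> 0 \<le> f x"
  shows "0 < sum f A \<longleftrightarrow> (\<exists>x\<in>A. 0 < f x)"
proof -
  have "0 < sum f A \<longleftrightarrow> sum f A \<noteq> 0"
    using sum_nonneg[of A f] assms(2) by (auto simp: less_le)
  also have "\<dots> \<longleftrightarrow> (\<exists>x\<in>A. f x \<noteq> 0)"
    using sum_nonneg_eq_0_iff[OF assms] by auto
  also have "\<dots> \<longleftrightarrow> (\<exists>x\<in>A. 0 < f x)"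
    using assms(2) by (auto simp: less_le)
  finally show ?thesis .
qed

lemma coeff_mult_pos_iff:
  fixes p q :: "int poly"
  assumes "\<And>i. 0 \<le> coeff p i" and "\<And>i. 0 \<le> coeff q i"
  shows "0 < coeff (p * q) v \<longleftrightarrow> (\<exists>u w. 0 < coeff p u \<and> 0 < coeff q w \<and> v = u + w)"
proof -
  have "0 < coeff (p * q) v \<longleftrightarrow> (\<exists>u\<le>v. 0 < coeff p u * coeff q (v - u))"
    unfolding coeff_mult using assms by (subst sum_nonneg_pos_iff) auto
  also have "\<dots> \<longleftrightarrow> (\<exists>u\<le>v. 0 < coeff p u \<and> 0 < coeff q (v - u))"
    using assms by (metis mult_pos_pos zero_less_mult_pos less_le mult_zero_left)
  also have "\<dots> \<longleftrightarrow> (\<exists>u w. 0 < coeff p u \<and> 0 < coeff q w \<and> v = u + w)"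
    by (metis add_diff_cancel_left' le_add1 le_add_diff_inverse)
  finally show ?thesis .
qed

lemma coeff_qbell_nonneg: "0 \<le> coeff (qbell n) i"
proof (induction n arbitrary: i rule: less_induct)
  case (less n)
  then show ?case
    by (cases n) (auto simp: coeff_1 coeff_sum coeff_qbinom_nonneg intro!: sum_nonneg coeff_mult_nonneg)
qed

lemma coeff_qbell_pos_iff: "0 < coeff (qbell n) v \<longleftrightarrow> v \<in> defects n"
proof (induction n arbitrary: v rule: less_induct)
  case (less n)
  show ?case
  proof (cases n)
    case 0
    then show ?thesis by (auto simp: defects_0 coeff_1)
  next
    case (Suc m)
    have "0 < coeff (qbell n) v \<longleftrightarrow> (\<exists>k\<le>m. 0 < coeff (qbinom m k * qbell k) v)"
      unfolding Suc qbell.simps coeff_sum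
      by (subst sum_nonneg_pos_iff)
        (auto intro!: coeff_mult_nonneg simp: coeff_qbinom_nonneg coeff_qbell_nonneg)
    also have "\<dots> \<longleftrightarrow> v \<in> defects n"
    proof -
      have "0 < coeff (qbinom m k * qbell k) v \<longleftrightarrow>
          (\<exists>u w. u \<le> k * (m - k) \<and> w \<in> defects k \<and> v = u + w)" if "k \<le> m" for k
        using that less[of k] Suc
        by (simp add: coeff_mult_pos_iff coeff_qbinom_nonneg coeff_qbell_nonneg coeff_qbinom_pos_iff)
      then show ?thesis unfolding Suc defects_Suc by blast
    qed
    finally show ?thesis .
  qed
qed

lemma num_terms_qbell: "num_terms (qbell n) = card (defects n)"
proof -
  have "coeff (qbell n) v \<noteq> 0 \<longleftrightarrow> v \<in> defects n" for v
    using coeff_qbell_nonneg[of n v] coeff_qbell_pos_iff[of n v] by linarith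
  then show ?thesis by (simp add: num_terms_def)
qed

section \<open>Height functions\<close>

text \<open>Columns count from 0 here, so weakly above the diagonal reads \<open>i < h i\<close>.
  Starting at \<open>s\<close> allows induction from one bounce point to the next.\<close>

definition admissible :: "nat \<Rightarrow> nat \<Rightarrow> (nat \<Rightarrow> nat) \<Rightarrow> bool" where
  "admissible s n h \<longleftrightarrow> (\<forall>i\<in>{s..<n}. i < h i \<and> h i \<le> n) \<and> mono_on {s..<n} h"

text \<open>
  The defect restricted to the columns from \<open>s\<close> on, for a bounce point \<open>s\<close>: the next bounce point is
  \<open>h s\<close>, and column \<open>s\<close> itself is left out.
\<close>

inductive defect :: "nat \<Rightarrow> (nat \<Rightarrow> nat) \<Rightarrow> nat \<Rightarrow> nat \<Rightarrow> bool" for n h where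
  defect_end: "defect n h n 0"
| defect_step: "s < h s \<Longrightarrow> h s \<le> n \<Longrightarrow> defect n h (h s) w \<Longrightarrow>
    defect n h s ((\<Sum>i\<in>{Suc s..<h s}. n - h i) + w)"

lemma defect_cong:
  "defect n h s v \<Longrightarrow> (\<And>i. s \<le> i \<Longrightarrow> i < n \<Longrightarrow> h' i = h i) \<Longrightarrow> defect n h' s v"
proof (induction rule: defect.induct)
  case (defect_step s w)
  have eq: "h' s = h s" using defect_step by simp
  have "(\<Sum>i\<in>{Suc s..<h s}. n - h i) = (\<Sum>i\<in>{Suc s..<h' s}. n - h' i)"
    using defect_step eq by (intro sum.cong) auto
  then show ?case
    using defect.defect_step[of s h' n w] defect_step eq by simp
qed (rule defect.defect_end)

text \<open>The iterates of \<open>h\<close> are the bounce points, and the column after one of them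
  contributes \<open>n\<close> minus the next. That \<open>m\<close> is the first index reaching
  \<open>n\<close> matches the \<open>LEAST\<close> in \<open>bounce\<close>.\<close>

lemma defect_sum:
  "defect n h s v \<Longrightarrow>
    \<exists>m. (h ^^ m) s = n \<and> (\<forall>k<m. (h ^^ k) s \<noteq> n) \<and>
      (\<Sum>i\<in>{s..<n}. n - h i) = (\<Sum>k=1..m. n - (h ^^ k) s) + v"
proof (induction rule: defect.induct)
  case defect_end
  show ?case by (intro exI[of _ 0]) auto
next
  case (defect_step s w)
  then obtain m where m: "(h ^^ m) (h s) = n" "\<And>k. k < m \<Longrightarrow> (h ^^ k) (h s) \<noteq> n"
    "(\<Sum>i\<in>{h s..<n}. n - h i) = (\<Sum>k=1..m. n - (h ^^ k) (h s)) + w"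
    by blast
  have shift: "(h ^^ Suc k) s = (h ^^ k) (h s)" for k
    by (simp only: funpow_Suc_right o_apply)
  have "{s..<n} = insert s ({Suc s..<h s} \<union> {h s..<n})"
    using defect_step by auto
  then have "(\<Sum>i\<in>{s..<n}. n - h i) =
      (n - h s) + ((\<Sum>i\<in>{Suc s..<h s}. n - h i) + (\<Sum>i\<in>{h s..<n}. n - h i))"
    using defect_step by (simp add: sum.union_disjoint)
  moreover have "(\<Sum>k=1..Suc m. n - (h ^^ k) s) = (n - h s) + (\<Sum>k=1..m. n - (h ^^ k) (h s))"
  proof -
    have "(\<Sum>k=1..Suc m. n - (h ^^ k) s) = (\<Sum>k=0..m. n - (h ^^ Suc k) s)"
      unfolding One_nat_def sum.shift_bounds_cl_Suc_ivl ..
    also have "\<dots> = (\<Sum>k=0..m. n - (h ^^ k) (h s))"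
      unfolding shift ..
    finally show ?thesis by (simp add: sum.atLeast_Suc_atMost)
  qed
  moreover have "\<forall>k<Suc m. (h ^^ k) s \<noteq> n"
    using m(2) defect_step shift by (auto simp: less_Suc_eq_0_disj simp del: funpow.simps(2))
  ultimately show ?case
    using m(1,3) by (intro exI[of _ "Suc m"]) (simp add: shift del: funpow.simps(2))
qed

text \<open>The block lengths between bounce points form the composition, with first part
  \<open>h s - s\<close>; by monotonicity each non-bounce column of that block contributes at most
  \<open>n - h s\<close>.\<close>

lemma admissible_defect:
  assumes "admissible s n h" and "s \<le> n"
  shows "\<exists>v\<in>defects (n - s). defect n h s v"
  using assms
proof (induction "n - s" arbitrary: s rule: less_induct)
  case less
  show ?case
  proof (cases "s = n")
    case True
    then show ?thesis by (auto simp: defects_0 intro: defect_end)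
  next
    case False
    then have s: "s < h s" "h s \<le> n"
      using less by (auto simp: admissible_def)
    have "admissible (h s) n h"
      using less s unfolding admissible_def by (auto intro: monotone_on_subset)
    then obtain w where w: "w \<in> defects (n - h s)" "defect n h (h s) w"
      using less.hyps[of "h s"] s by fastforce
    define u where "u = (\<Sum>i\<in>{Suc s..<h s}. n - h i)"
    have "u \<le> (\<Sum>i\<in>{Suc s..<h s}. n - h s)"
      unfolding u_def using less s
      by (intro sum_mono diff_le_mono2) (auto simp: admissible_def mono_on_def)
    then have "u \<le> (h s - s - 1) * (n - h s)" by simp
    then have "u + w \<in> defects ((h s - s) + (n - h s))"
      using w s by (intro defects_extend) auto
    then show ?thesis
      using defect_step[OF s w(2)] s unfolding u_def by auto
  qed
qed

section \<open>Height functions with a prescribed defect\<close>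

lemma exists_mono_with_sum:
  fixes a b k u :: nat
  assumes "k * a \<le> u" and "u \<le> k * (a + b)"
  shows "\<exists>f. mono_on {..<k} f \<and> (\<forall>i<k. a \<le> f i \<and> f i \<le> a + b) \<and> (\<Sum>i<k. f i) = u"
  using assms
proof (induction k arbitrary: u b)
  case 0
  then show ?case by (auto simp: mono_on_def)
next
  case (Suc k)
  \<comment> \<open>The last value is taken as large as possible while leaving \<open>a\<close> for
    each of the other \<open>k\<close>. Either it hits the cap, or all others equal
    \<open>a\<close>; so the others fit below it.\<close>
  define t where "t = min (a + b) (u - k * a)"
  have t: "a \<le> t" "t \<le> a + b" "k * a \<le> u - t" "t \<le> u"
    using Suc.prems by (auto simp: t_def)
  have "u - t \<le> k * (a + (t - a))"
  proof (cases "a + b \<le> u - k * a")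
    case True
    then have "t = a + b" by (simp add: t_def)
    then show ?thesis using Suc.prems by simp
  next
    case False
    then have "u - t = k * a"
      using Suc.prems by (simp add: t_def)
    then show ?thesis by (simp add: add_mult_distrib2)
  qed
  then obtain f where f: "mono_on {..<k} f" "(\<Sum>i<k. f i) = u - t" "\<And>i. i < k \<Longrightarrow> a \<le> f i \<and> f i \<le> t"
    using Suc.IH[of "u - t" "t - a"] t by auto
  show ?case
  proof (intro exI[of _ "f(k := t)"] conjI)
    show "mono_on {..<Suc k} (f(k := t))"
      using f(1,3) by (auto simp: mono_on_def less_Suc_eq)
    show "\<forall>i<Suc k. a \<le> (f(k := t)) i \<and> (f(k := t)) i \<le> a + b"
      using f(3) t by (force simp: less_Suc_eq)
    show "(\<Sum>i<Suc k. (f(k := t)) i) = u"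
      using f(2) t by simp
  qed
qed

lemma between_sum_split:
  fixes v :: nat
  assumes "a + b \<le> v" and "v \<le> c + d" and "a \<le> c" and "b \<le> d"
  obtains u w where "v = u + w" "a \<le> u" "u \<le> c" "b \<le> w" "w \<le> d"
proof (rule that[of "min c (v - b)" "v - min c (v - b)"])
qed (use assms in auto)

lemma min_defect_le_max_defect: "min_defect cs \<le> max_defect cs"
proof (induction cs)
  case (Cons c cs)
  have "sum_list (tl cs) \<le> sum_list cs" by (cases cs) auto
  with Cons show ?case by (auto intro!: add_mono)
qed simp

text \<open>Built block by block from the right. The value of \<open>h s\<close> is carried along
  because it caps the heights of the block before.\<close>

lemma height_function_with_defect:
  assumes "0 \<notin> set cs" and "s + sum_list cs = n"
    and "min_defect cs \<le> v" and "v \<le> max_defect cs"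
  shows "\<exists>h. admissible s n h \<and> (cs \<noteq> [] \<longrightarrow> h s = s + hd cs) \<and> defect n h s v"
  using assms
proof (induction cs arbitrary: s v)
  case Nil
  then show ?case
    by (auto simp: admissible_def monotone_on_def intro: defect_end)
next
  case (Cons c cs)
  define r where "r = s + c"
  \<comment> \<open>The rise from \<open>r\<close> to the following bounce point; with no part left
    \<open>r = n\<close>, and the value 0 keeps \<open>r + d = n\<close>.\<close>
  define d where "d = (if cs = [] then 0 else hd cs)"
  have sum_cs: "sum_list cs = d + sum_list (tl cs)" by (cases cs) (auto simp: d_def)
  have c: "0 < c" "r + sum_list cs = n" "s < r" using Cons.prems by (auto simp: r_def)
  obtain u w where uw: "v = u + w" "(c - 1) * sum_list (tl cs) \<le> u" "u \<le> (c - 1) * sum_list cs"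
    "min_defect cs \<le> w" "w \<le> max_defect cs"
    using between_sum_split[of "(c - 1) * sum_list (tl cs)" "min_defect cs" v
        "(c - 1) * sum_list cs" "max_defect cs"] Cons.prems sum_cs min_defect_le_max_defect[of cs]
    by (auto simp: add_mult_distrib2)
  obtain h where h: "admissible r n h" "cs \<noteq> [] \<Longrightarrow> h r = r + d" "defect n h r w"
    using Cons.IH[of r w] Cons.prems uw c by (auto simp: d_def)
  \<comment> \<open>Bounds on the complements \<open>n - h i\<close> become bounds on the heights:
    the \<open>c - 1\<close> free columns need the sum \<open>(c - 1) * n - u\<close> with values
    from \<open>r\<close> to \<open>r + d\<close>.\<close>
  have "(c - 1) * n = (c - 1) * r + (c - 1) * sum_list cs"
    using c by (metis add_mult_distrib2)
  moreover have "(c - 1) * n = (c - 1) * (r + d) + (c - 1) * sum_list (tl cs)"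
    using c sum_cs by (metis add_mult_distrib2 add.assoc)
  ultimately have "(c - 1) * r \<le> (c - 1) * n - u" "(c - 1) * n - u \<le> (c - 1) * (r + d)"
    and u_le: "u \<le> (c - 1) * n"
    using uw by linarith+
  then obtain f where f: "mono_on {..<c - 1} f" "\<And>i. i < c - 1 \<Longrightarrow> r \<le> f i \<and> f i \<le> r + d"
    "(\<Sum>i<c - 1. f i) = (c - 1) * n - u"
    using exists_mono_with_sum by metis
  \<comment> \<open>Column \<open>s\<close> gets height \<open>r\<close>, so that \<open>r\<close>
    is the next bounce point; \<open>f\<close> fills the rest of the block and \<open>h\<close>
    takes over from \<open>r\<close>.\<close>
  define g where "g i = (if i \<le> s then r else if i < r then f (i - Suc s) else h i)" for i
  have g_low: "r \<le> g i" "g i \<le> r + d" if "s \<le> i" "i < r" for i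
    using that f(2)[of "i - Suc s"] by (auto simp: g_def r_def)
  have g_high: "g i = h i" if "r \<le> i" for i
    using that c by (auto simp: g_def)
  have rd: "r + d \<le> n" using c sum_cs by simp
  \<comment> \<open>This secures monotonicity across the seam at \<open>r\<close>.\<close>
  have h_low: "r + d \<le> h i" if "r \<le> i" "i < n" for i
  proof -
    have "cs \<noteq> []" using that c by auto
    then have "r + d = h r" using h(2) by simp
    also have "\<dots> \<le> h i"
      using h(1) that unfolding admissible_def by (intro mono_onD[of "{r..<n}" h]) auto
    finally show ?thesis .
  qed
  have "mono_on {s..<n} g"
  proof (rule mono_onI)
    fix i j assume ij: "i \<in> {s..<n}" "j \<in> {s..<n}" "i \<le> j"
    consider "r \<le> i" | "i < r" "r \<le> j" | "j < r" by linarith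
    then show "g i \<le> g j"
    proof cases
      case 1
      then show ?thesis using ij h(1) by (auto simp: g_high admissible_def mono_on_def)
    next
      case 2
      then show ?thesis using ij g_low(2)[of i] h_low[of j] by (simp add: g_high)
    next
      case 3
      show ?thesis
      proof (cases "i = s")
        case True
        then show ?thesis using g_low(1)[of j] 3 ij by (simp add: g_def)
      next
        case False
        then show ?thesis
          using 3 ij mono_onD[OF f(1), of "i - Suc s" "j - Suc s"] by (auto simp: g_def r_def)
      qed
    qed
  qed
  moreover have "i < g i \<and> g i \<le> n" if "i \<in> {s..<n}" for i
    using that g_low[of i] rd h(1) g_high[of i] by (cases "i < r") (auto simp: admissible_def)
  ultimately have adm: "admissible s n g" by (auto simp: admissible_def)
  have gs: "g s = r" by (simp add: g_def)
  have "(\<Sum>i\<in>{Suc s..<r}. n - g i) = (\<Sum>i<c - 1. n - f i)"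
    using c unfolding g_def r_def
    by (intro sum.reindex_bij_witness[of _ "\<lambda>i. i + Suc s" "\<lambda>i. i - Suc s"]) auto
  also have "\<dots> = (c - 1) * n - (\<Sum>i<c - 1. f i)"
    using f(2) rd by (subst sum_subtractf_nat) (auto intro: order_trans)
  also have "\<dots> = u" using f(3) u_le by simp
  finally have "defect n g s v"
    using defect_step[of s g n w] defect_cong[OF h(3), of g] gs c rd uw(1) g_high by simp
  then show ?case using adm gs by (auto simp: r_def)
qed

lemma exists_height_function:
  assumes "v \<in> defects n"
  shows "\<exists>h. admissible 0 n h \<and> defect n h 0 v"
proof -
  obtain cs where "sum_list cs = n" "0 \<notin> set cs" "v \<le> max_defect cs"
    using assms by (auto simp: defects_def)
  then show ?thesis
    using composition_with_defect[of cs v] height_function_with_defect[of _ 0 n v] by (metis add_0)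
qed

section \<open>Dyck paths\<close>

fun heights :: "nat \<Rightarrow> step list \<Rightarrow> nat list" where
  "heights y [] = []"
| "heights y (North # p) = heights (Suc y) p"
| "heights y (East # p) = y # heights y p"

lemma length_heights [simp]: "length (heights y p) = count_list p East"
  by (induction y p rule: heights.induct) auto

lemma sorted_heights: "sorted (heights y p) \<and> (\<forall>z\<in>set (heights y p). y \<le> z)"
  by (induction y p rule: heights.induct) auto

lemma heights_nth_east:
  "k < length p \<Longrightarrow> p ! k = East \<Longrightarrow>
    heights y p ! count_list (take k p) East = y + count_list (take k p) North"
proof (induction y p arbitrary: k rule: heights.induct)
  case (2 y p)
  then show ?case by (cases k) auto
next
  case (3 y p)
  then show ?case by (cases k) auto
qed simp

lemma exists_east_step:
  "i < count_list p East \<Longrightarrow> \<exists>k<length p. p ! k = East \<and> count_list (take k p) East = i"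
proof (induction p arbitrary: i)
  case (Cons a p)
  show ?case
  proof (cases "a = East \<and> i = 0")
    case True
    then show ?thesis by (intro exI[of _ 0]) auto
  next
    case False
    define j where "j = (if a = East then i - 1 else i)"
    have "j < count_list p East" using Cons.prems False by (auto simp: j_def split: if_splits)
    then obtain k where "k < length p" "p ! k = East" "count_list (take k p) East = j"
      using Cons.IH by blast
    then show ?thesis using False by (intro exI[of _ "Suc k"]) (auto simp: j_def)
  qed
qed simp

lemma path_point_after_east:
  assumes "k < length p" and "p ! k = East"
  shows "path_point p (Suc k) = (Suc (count_list (take k p) East), count_list (take k p) North)"
  using assms by (simp add: path_point_def take_Suc_conv_app_nth)

text \<open>An east step ending at \<open>x = Suc i\<close> has exactly \<open>i\<close> east steps
  before it, which makes the definite description unique. The second claim supplies the lattice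
  point to which the Dyck condition is applied.\<close>

lemma col_height_eq_heights:
  assumes "i < count_list p East"
  shows "col_height p (Suc i) = heights 0 p ! i"
    and "\<exists>k<length p. path_point p (Suc k) = (Suc i, heights 0 p ! i)"
proof -
  obtain k where k: "k < length p" "p ! k = East" "count_list (take k p) East = i"
    using exists_east_step[OF assms] by blast
  then have pt: "path_point p (Suc k) = (Suc i, heights 0 p ! i)"
    using path_point_after_east[of k p] heights_nth_east[of k p 0] by auto
  then show "\<exists>k<length p. path_point p (Suc k) = (Suc i, heights 0 p ! i)" using k by blast
  show "col_height p (Suc i) = heights 0 p ! i"
    unfolding col_height_def
  proof (rule the_equality)
    show "\<exists>k<length p. p ! k = East \<and> path_point p (Suc k) = (Suc i, heights 0 p ! i)"
      using pt k by blast
  next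
    fix y assume "\<exists>k<length p. p ! k = East \<and> path_point p (Suc k) = (Suc i, y)"
    then show "y = heights 0 p ! i"
      using heights_nth_east[of _ p 0] by (auto simp: path_point_after_east)
  qed
qed

lemma count_list_take_le: "count_list (take k p) x \<le> count_list p x"
  by (metis append_take_drop_id count_list_append le_add1)

lemma admissible_dyck_path:
  assumes "p \<in> dyck_paths n"
  shows "admissible 0 n (\<lambda>i. col_height p (Suc i))"
proof -
  have cnt: "count_list p East = n" "count_list p North = n"
    using assms by (auto simp: dyck_paths_def path_point_def)
  have "i < heights 0 p ! i \<and> heights 0 p ! i \<le> n" if "i < n" for i
  proof -
    have "i < count_list p East" using that cnt(1) by simp
    then obtain k where k: "k < length p" "path_point p (Suc k) = (Suc i, heights 0 p ! i)"
      using col_height_eq_heights(2) by blast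
    moreover have "snd (path_point p (Suc k)) \<le> n"
      using cnt count_list_take_le[of "Suc k" p North] by (simp add: path_point_def)
    \<comment> \<open>The point after the east step has \<open>x = Suc i\<close>, so the weak
      inequality yields the strict one.\<close>
    moreover have "fst (path_point p (Suc k)) \<le> snd (path_point p (Suc k))"
      using assms k(1) unfolding dyck_paths_def by simp
    ultimately show ?thesis by simp
  qed
  moreover have "heights 0 p ! i \<le> heights 0 p ! j" if "i \<le> j" "j < n" for i j
    using sorted_heights[of 0 p] that cnt by (auto intro: sorted_nth_mono)
  ultimately show ?thesis
    using cnt by (auto simp: admissible_def mono_on_def col_height_eq_heights)
qed

section \<open>Area and bounce in terms of column heights\<close>

lemma bounce_point_eq_funpow: "bounce_point p k = ((\<lambda>i. col_height p (Suc i)) ^^ k) 0"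
  by (induction k) auto

text \<open>In each column the cells above the diagonal split into those below the path and those
  above it.\<close>

lemma area_plus_heights:
  assumes "\<And>i. i < n \<Longrightarrow> i < col_height p (Suc i) \<and> col_height p (Suc i) \<le> n"
  shows "area n p + (\<Sum>i<n. n - col_height p (Suc i)) = (\<Sum>i<n. n - Suc i)"
proof -
  have "{(i, j). 1 \<le> i \<and> i \<le> n \<and> i < j \<and> j \<le> col_height p i} = (SIGMA i:{1..n}. {i<..col_height p i})"
    by auto
  then have "area n p = (\<Sum>i=1..n. col_height p i - i)"
    by (simp add: area_def)
  also have "\<dots> = (\<Sum>i<n. col_height p (Suc i) - Suc i)"
    by (intro sum.reindex_bij_witness[of _ Suc "\<lambda>i. i - 1"]) auto
  finally have "area n p + (\<Sum>i<n. n - col_height p (Suc i)) =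
      (\<Sum>i<n. (col_height p (Suc i) - Suc i) + (n - col_height p (Suc i)))"
    by (simp add: sum.distrib)
  also have "\<dots> = (\<Sum>i<n. n - Suc i)"
    using assms by (intro sum.cong) (auto simp: Suc_le_eq)
  finally show ?thesis .
qed

lemma area_bounce_defect:
  assumes "p \<in> dyck_paths n" and "defect n (\<lambda>i. col_height p (Suc i)) 0 v"
  shows "area n p + bounce n p + v = (\<Sum>i<n. n - Suc i)"
proof -
  obtain m where m: "bounce_point p m = n" "\<And>k. k < m \<Longrightarrow> bounce_point p k \<noteq> n"
    "(\<Sum>i\<in>{0..<n}. n - col_height p (Suc i)) = (\<Sum>k=1..m. n - bounce_point p k) + v"
    using defect_sum[OF assms(2)] unfolding bounce_point_eq_funpow by blast
  have "(LEAST m. bounce_point p m = n) = m"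
    using m(1,2) by (intro Least_equality) (auto simp: not_less[symmetric])
  then have "bounce n p + v = (\<Sum>i<n. n - col_height p (Suc i))"
    using m(3) by (simp add: bounce_def atLeast0LessThan)
  then show ?thesis
    using area_plus_heights[of n p] admissible_dyck_path[OF assms(1)] by (simp add: admissible_def)
qed

section \<open>From column heights back to a path\<close>

primrec path_of_heights :: "nat \<Rightarrow> nat list \<Rightarrow> step list" where
  "path_of_heights y [] = []"
| "path_of_heights y (z # zs) = replicate (z - y) North @ East # path_of_heights z zs"

lemma heights_norths: "heights y (replicate k North @ p) = heights (y + k) p"
  by (induction k arbitrary: y) auto

lemma heights_path_of_heights:
  "sorted (y # zs) \<Longrightarrow> heights y (path_of_heights y zs) = zs"
  by (induction zs arbitrary: y) (auto simp: heights_norths)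

lemma count_list_replicate: "count_list (replicate k x) y = (if x = y then k else 0)"
  by (induction k) auto

lemma count_path_of_heights:
  "count_list (path_of_heights y zs) East = length zs"
  "sorted (y # zs) \<Longrightarrow> y + count_list (path_of_heights y zs) North = last (y # zs)"
  by (induction zs arbitrary: y) (auto simp: count_list_replicate)

text \<open>The start \<open>(x, y)\<close> is general because the induction restarts at
  \<open>(Suc x, z)\<close>, just after the first east step.\<close>

lemma path_of_heights_above_diagonal:
  assumes "sorted (y # zs)" and "x \<le> y" and "\<And>i. i < length zs \<Longrightarrow> x + i < zs ! i"
  shows "x + count_list (take k (path_of_heights y zs)) East
    \<le> y + count_list (take k (path_of_heights y zs)) North"
  using assms
proof (induction zs arbitrary: x y k)
  case (Cons z zs)
  show ?case
  proof (cases "k \<le> z - y")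
    case True
    then show ?thesis using Cons.prems by (simp add: count_list_replicate)
  next
    case False
    \<comment> \<open>\<open>l\<close> counts the steps beyond the first east step.\<close>
    then obtain l where l: "k = (z - y) + Suc l"
      by (metis add_Suc_right less_iff_Suc_add not_le)
    have "Suc x + i < zs ! i" if "i < length zs" for i
      using Cons.prems(3)[of "Suc i"] that by simp
    moreover have "x < z" using Cons.prems(3)[of 0] by simp
    ultimately have "Suc x + count_list (take l (path_of_heights z zs)) East
        \<le> z + count_list (take l (path_of_heights z zs)) North"
      using Cons.prems by (intro Cons.IH) auto
    then show ?thesis using Cons.prems by (simp add: l count_list_replicate)
  qed
qed simp

lemma exists_dyck_path:
  assumes "admissible 0 n h"
  shows "\<exists>p\<in>dyck_paths n. \<forall>i<n. col_height p (Suc i) = h i"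
proof -
  define zs where "zs = map h [0..<n]"
  define p where "p = path_of_heights 0 zs"
  have h: "\<And>i. i < n \<Longrightarrow> i < h i \<and> h i \<le> n" "\<And>i j. i \<le> j \<Longrightarrow> j < n \<Longrightarrow> h i \<le> h j"
    using assms by (auto simp: admissible_def mono_on_def)
  have srt: "sorted (0 # zs)"
    using h(2) by (auto simp: zs_def sorted_iff_nth_mono)
  \<comment> \<open>Column \<open>n - 1\<close> is forced to height \<open>n\<close>, so no north
    steps are missing at the end; for \<open>n = 0\<close> the leading 0 is the last entry.\<close>
  have "last (0 # zs) = n"
    using h(1)[of "n - 1"] by (cases n) (auto simp: zs_def)
  then have cnt: "count_list p East = n" "count_list p North = n"
    using count_path_of_heights(1)[of 0 zs] count_path_of_heights(2)[OF srt]
    unfolding p_def by (auto simp: zs_def)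
  have "count_list (take k p) East \<le> count_list (take k p) North" for k
    using path_of_heights_above_diagonal[OF srt, of 0 k] h(1) unfolding p_def by (simp add: zs_def)
  then have "p \<in> dyck_paths n"
    using cnt by (simp add: dyck_paths_def path_point_def)
  moreover have "col_height p (Suc i) = h i" if "i < n" for i
    using that cnt heights_path_of_heights[OF srt] col_height_eq_heights(1)[of i p]
    by (simp add: p_def zs_def)
  ultimately show ?thesis by blast
qed

text \<open>Area, bounce and defect have a constant sum. The bound makes the truncated subtraction
  injective on \<open>defects n\<close>.\<close>

lemma area_bounce_values:
  "(\<lambda>p. area n p + bounce n p) ` dyck_paths n = (\<lambda>v. (\<Sum>i<n. n - Suc i) - v) ` defects n"
  and defects_bounded: "v \<in> defects n \<Longrightarrow> v \<le> (\<Sum>i<n. n - Suc i)"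
proof -
  have surj: "\<exists>p\<in>dyck_paths n. area n p + bounce n p + v = (\<Sum>i<n. n - Suc i)" if v: "v \<in> defects n" for v
  proof -
    obtain h where h: "admissible 0 n h" "defect n h 0 v"
      using exists_height_function[OF v] by blast
    then obtain p where p: "p \<in> dyck_paths n" "\<forall>i<n. col_height p (Suc i) = h i"
      using exists_dyck_path by blast
    then show ?thesis
      using area_bounce_defect[OF p(1) defect_cong[OF h(2)]] by blast
  qed
  then show "v \<in> defects n \<Longrightarrow> v \<le> (\<Sum>i<n. n - Suc i)"
    by (metis le_add2)
  have "\<exists>v\<in>defects n. area n p + bounce n p + v = (\<Sum>i<n. n - Suc i)" if p: "p \<in> dyck_paths n" for p
    using admissible_defect[OF admissible_dyck_path[OF p]] area_bounce_defect[OF p] by auto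
  then show "(\<lambda>p. area n p + bounce n p) ` dyck_paths n = (\<lambda>v. (\<Sum>i<n. n - Suc i) - v) ` defects n"
    using surj by (auto simp: image_iff) (metis diff_add_inverse2)+
qed

lemma num_values_eq_card_defects: "num_values n = card (defects n)"
  unfolding num_values_def area_bounce_values
proof (intro card_image inj_onI)
  fix v w
  assume "v \<in> defects n" "w \<in> defects n"
    and "(\<Sum>i<n. n - Suc i) - v = (\<Sum>i<n. n - Suc i) - w"
  then show "v = w"
    using defects_bounded[of v n] defects_bounded[of w n] by linarith
qed

section \<open>The generating function of area plus bounce\<close>

lemma length_step_list: "length p = count_list p North + count_list p East"
proof (induction p)
  case (Cons a p)
  then show ?case by (cases a) auto
qed simp

lemma finite_dyck_paths: "finite (dyck_paths n)"
proof (rule finite_subset)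
  have "set p \<subseteq> {North, East}" for p
    by (metis insertCI step.exhaust subsetI)
  then show "dyck_paths n \<subseteq> {p. set p \<subseteq> {North, East} \<and> length p = n + n}"
    by (auto simp: dyck_paths_def path_point_def length_step_list)
qed (simp add: finite_lists_length_eq)

text \<open>All monomials have coefficient 1, so equal exponents add up without cancelling.\<close>

lemma num_terms_sum_monom:
  assumes "finite A"
  shows "num_terms (\<Sum>x\<in>A. monom 1 (f x)) = card (f ` A)"
proof -
  have "0 < coeff (\<Sum>x\<in>A. monom (1 :: int) (f x)) i \<longleftrightarrow> i \<in> f ` A" for i
    unfolding coeff_sum using assms by (subst sum_nonneg_pos_iff) auto
  moreover have "0 \<le> coeff (\<Sum>x\<in>A. monom (1 :: int) (f x)) i" for i
    unfolding coeff_sum by (intro sum_nonneg) auto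
  ultimately have "{i. coeff (\<Sum>x\<in>A. monom (1 :: int) (f x)) i \<noteq> 0} = f ` A"
    by (metis (mono_tags, lifting) Collect_mem_eq Collect_cong less_le)
  then show ?thesis by (simp add: num_terms_def)
qed

theorem theorem5p1:
  fixes n :: nat
  shows "num_values n = num_terms (qbell n) \<and>
         num_values n = num_terms (\<Sum>\<pi>\<in>dyck_paths n. monom 1 (area n \<pi> + bounce n \<pi>))"
proof
  show "num_values n = num_terms (qbell n)"
    by (simp add: num_values_eq_card_defects num_terms_qbell)
  show "num_values n = num_terms (\<Sum>\<pi>\<in>dyck_paths n. monom 1 (area n \<pi> + bounce n \<pi>))"
    by (simp add: num_terms_sum_monom finite_dyck_paths num_values_def)
qed

end
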